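(* Let $\tau$ be a monomial order on $S=K[x_1,\dots,x_n]$ (in the sense of the context) and let $I\subset S$ be a homogeneous ideal. If $in_\tau(I)$ is a $\tau$-segment ideal, then $gin_\tau(I)=in_\tau(I)$.
   Context: $K$ is an algebraically closed field of characteristic $0$ and $S=K[x_1,\dots,x_n]$ is the standard graded polynomial ring; $S_1$ is its space of linear forms. A monomial order $\tau$ means a total order $>_\tau$ on the monomials of $S$ with $x_1>_\tau x_2>_\tau\dots>_\tau x_n$ that is graded ($\deg f>\deg g$ implies $f>_\tau g$ for monomials $f,g$) and multiplicative ($f>_\tau g$ implies $fh>_\tau gh$ for monomials $f,g,h$). For a nonzero $f\in S$, $in_\tau(f)$ is its $\tau$-largest monomial, and for an ideal $I$, $in_\tau(I)$ is the monomial ideal generated by all $in_\tau(f)$, $0\neq f\in I$. A matrix $g\in GL(S_1)$ acts on $S$ by the induced linear change of coordinates. By a theorem of Galligo, for a given ideal $I$ and monomial order $\tau$ there is a nonempty Zariski open subset $U\subset GL(S_1)$ such that $in_\tau(g(I))$ is the same ideal for all $g\in U$; this ideal is the generic initial ideal, denoted $gin_\tau(I)$. A finite set $B=\{f_1,\dots,f_k\}$ of monomials of $S$ (possibly of different degrees) is a $\tau$-segment if, whenever $f\in B$ and $g$ is a monomial of $S$ with $\deg g=\deg f$ and $g>_\tau f$, one has $g\in B$. An ideal is a $\tau$-segment ideal if it is generated by a $\tau$-segment. (It is not required that the monomials of the ideal form a $\tau$-segment in every degree.) *)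

theory Defs
  imports
    "HOL-Analysis.Determinants"
    "HOL-Library.Poly_Mapping"
    "HOL-Computational_Algebra.Polynomial"
begin

text \<open>
  Monomials are exponent vectors, written additively. The variables are indexed by a finite
  linearly ordered type \<open>'n\<close>, so that \<open>n = CARD('n)\<close> and \<open>x\<^sub>1, \<dots>, x\<^sub>n\<close> are the variables in
  increasing order of their indices.
\<close>

type_synonym 'v mon = "'v \<Rightarrow>\<^sub>0 nat"
type_synonym ('v, 'k) mpoly = "'v mon \<Rightarrow>\<^sub>0 'k"

definition mdeg :: "'v mon \<Rightarrow> nat"
  where "mdeg m = (\<Sum>v\<in>Poly_Mapping.keys m. Poly_Mapping.lookup m v)"

definition mvar :: "'v \<Rightarrow> 'v mon"
  where "mvar v = Poly_Mapping.single v 1"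

definition of_mon :: "'v mon \<Rightarrow> ('v, 'k::zero_neq_one) mpoly"
  where "of_mon m = Poly_Mapping.single m 1"

definition const :: "'k \<Rightarrow> ('v, 'k::zero) mpoly"
  where "const c = Poly_Mapping.single 0 c"

text \<open>
  The value of a polynomial at \<open>x\<^sub>v = a v\<close>, with coefficients mapped by \<open>\<phi>\<close>. It is used with
  \<open>\<phi> = id\<close> (evaluation at a point) and with \<open>\<phi> = const\<close> (substitution of polynomials).
\<close>

definition eval_with :: "('k::zero \<Rightarrow> 'b::comm_semiring_1) \<Rightarrow> ('v \<Rightarrow> 'b) \<Rightarrow> ('v, 'k) mpoly \<Rightarrow> 'b"
  where "eval_with \<phi> a p =
    (\<Sum>m\<in>Poly_Mapping.keys p.
       \<phi> (Poly_Mapping.lookup p m) * (\<Prod>v\<in>Poly_Mapping.keys m. a v ^ Poly_Mapping.lookup m v))"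

text \<open>
  The ideals of a commutative ring are its submodules as a module over itself:
  \<open>ideal.subspace I\<close> says that \<open>I\<close> is an ideal, and \<open>ideal.span F\<close> is the ideal generated by \<open>F\<close>.
\<close>

interpretation ideal: module "(*) :: 'a::comm_ring_1 \<Rightarrow> 'a \<Rightarrow> 'a"
  by unfold_locales (simp_all add: algebra_simps)

definition homogeneous :: "('v, 'k::zero) mpoly \<Rightarrow> bool"
  where "homogeneous p \<longleftrightarrow> (\<exists>d. \<forall>m\<in>Poly_Mapping.keys p. mdeg m = d)"

definition homogeneous_ideal :: "('v, 'k::comm_ring_1) mpoly set \<Rightarrow> bool"
  where "homogeneous_ideal I \<longleftrightarrow> (\<exists>F. (\<forall>f\<in>F. homogeneous f) \<and> I = ideal.span F)"

text \<open>In what follows \<open>gt f g\<close> stands for \<open>f >\<^sub>\<tau> g\<close>.\<close>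

definition monomial_order :: "('n::linorder mon \<Rightarrow> 'n mon \<Rightarrow> bool) \<Rightarrow> bool"
  where "monomial_order gt \<longleftrightarrow>
    irreflp gt \<and> transp gt \<and> totalp gt \<and>
    (\<forall>i j. i < j \<longrightarrow> gt (mvar i) (mvar j)) \<and>
    (\<forall>f g. mdeg f > mdeg g \<longrightarrow> gt f g) \<and>
    (\<forall>f g h. gt f g \<longrightarrow> gt (f + h) (g + h))"

definition lead_mon :: "('v mon \<Rightarrow> 'v mon \<Rightarrow> bool) \<Rightarrow> ('v, 'k::zero) mpoly \<Rightarrow> 'v mon"
  where "lead_mon gt f =
    (THE m. m \<in> Poly_Mapping.keys f \<and> (\<forall>m'\<in>Poly_Mapping.keys f. m' \<noteq> m \<longrightarrow> gt m m'))"

definition initial_ideal ::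
    "('v mon \<Rightarrow> 'v mon \<Rightarrow> bool) \<Rightarrow> ('v, 'k::comm_ring_1) mpoly set \<Rightarrow> ('v, 'k) mpoly set"
  where "initial_ideal gt I = ideal.span {of_mon (lead_mon gt f) | f. f \<in> I \<and> f \<noteq> 0}"

definition segment :: "('v mon \<Rightarrow> 'v mon \<Rightarrow> bool) \<Rightarrow> 'v mon set \<Rightarrow> bool"
  where "segment gt B \<longleftrightarrow>
    finite B \<and> (\<forall>f\<in>B. \<forall>g. mdeg g = mdeg f \<and> gt g f \<longrightarrow> g \<in> B)"

definition segment_ideal :: "('v mon \<Rightarrow> 'v mon \<Rightarrow> bool) \<Rightarrow> ('v, 'k::comm_ring_1) mpoly set \<Rightarrow> bool"
  where "segment_ideal gt J \<longleftrightarrow> (\<exists>B. segment gt B \<and> J = ideal.span (of_mon ` B))"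

text \<open>
  A matrix is identified with the linear map of the space of linear forms that it represents in the
  basis of the variables: \<open>g\<close> sends \<open>x\<^sub>j\<close> to the sum of the \<open>g\<^sub>i\<^sub>j x\<^sub>i\<close> over all \<open>i\<close>.
\<close>

definition change_coords ::
    "'k::comm_ring_1 ^ 'n ^ 'n \<Rightarrow> ('n::finite, 'k) mpoly \<Rightarrow> ('n, 'k) mpoly"
  where "change_coords g p =
    eval_with const (\<lambda>j. \<Sum>i\<in>UNIV. const (g $ i $ j) * of_mon (mvar i)) p"

definition GL :: "('k::field ^ 'n ^ 'n) set"
  where "GL = {g. invertible g}"

text \<open>
  The coordinate ring of \<open>GL\<close> is generated by the matrix entries and the inverse of the determinant.
  The latter is a unit, so the Zariski closed subsets of \<open>GL\<close> are already the zero sets in \<open>GL\<close> of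
  families of polynomials in the matrix entries.
\<close>

definition zariski_open_GL :: "('k::field ^ 'n ^ 'n) set \<Rightarrow> bool"
  where "zariski_open_GL U \<longleftrightarrow>
    (\<exists>P :: ('n \<times> 'n, 'k) mpoly set.
       U = {g \<in> GL. \<exists>p\<in>P. eval_with id (\<lambda>(i, j). g $ i $ j) p \<noteq> 0})"

text \<open>
  The following is well defined: existence is Galligo's theorem, and two nonempty Zariski open
  subsets of \<open>GL\<close> over an infinite field always meet.
\<close>

definition gin ::
    "('n::finite mon \<Rightarrow> 'n mon \<Rightarrow> bool) \<Rightarrow> ('n, 'k::field) mpoly set \<Rightarrow> ('n, 'k) mpoly set"
  where "gin gt I =
    (THE J. \<exists>U. zariski_open_GL U \<and> U \<noteq> {} \<and>
                (\<forall>g\<in>U. initial_ideal gt (change_coords g ` I) = J))"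

end

theory Submission
  imports Defs "Jordan_Normal_Form.Determinant"
begin

text \<open>
  Write \<open>LM(J)\<close> for the set of leading monomials of the nonzero elements of an ideal \<open>J\<close>. A monomial
  lies in the initial ideal of \<open>J\<close> exactly if it lies in \<open>LM(J)\<close>, so two ideals have the same initial
  ideal as soon as they have the same leading monomials. The proof shows \<open>LM(g(I)) = LM(I)\<close> for all
  \<open>g\<close> in a Zariski open set that contains the identity matrix.

  Let \<open>b\<close> belong to the segment \<open>B\<close> that generates the initial ideal of \<open>I\<close>, and let
  \<open>m\<^sub>1 > \<dots> > m\<^sub>s = b\<close> be all the monomials of degree \<open>deg b\<close> that are not below \<open>b\<close>. Since \<open>B\<close> is
  a segment, each \<open>m\<^sub>i\<close> is the leading monomial of some \<open>f\<^sub>i \<in> I\<close>. The coefficients of \<open>g(f\<^sub>i)\<close> at the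
  \<open>m\<^sub>j\<close> form a square matrix whose determinant \<open>D(g)\<close> is a polynomial in the entries of \<open>g\<close>. For
  \<open>g = 1\<close> the matrix is triangular with nonzero diagonal, so \<open>D(1) \<noteq> 0\<close>. Whenever \<open>D(g) \<noteq> 0\<close>, some
  linear combination of the \<open>g(f\<^sub>i)\<close> has coefficient zero at \<open>m\<^sub>1, \<dots>, m\<^sub>s\<^sub>-\<^sub>1\<close> and nonzero coefficient at
  \<open>b\<close>. Its degree is at most \<open>deg b\<close> and the order is graded, so its leading monomial is \<open>b\<close>. This is
  \<open>lead_mons_change_coords_generic\<close>.

  The product of these determinants over the finite set \<open>B\<close> cuts out an open set \<open>U\<close> with
  \<open>B \<subseteq> LM(g(I))\<close>, hence \<open>LM(I) \<subseteq> LM(g(I))\<close>, for \<open>g \<in> U\<close>. Equality follows by counting dimensions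
  (\<open>lead_mons_change_coords_eq\<close>): the elements of degree at most \<open>d\<close> of an ideal form a vector space
  whose dimension is the number of its leading monomials of degree at most \<open>d\<close>, and \<open>g\<close> is an
  isomorphism between these spaces for \<open>I\<close> and \<open>g(I)\<close>.

  Finally \<open>gin\<close> is a definite description, so uniqueness is needed too: it holds because two nonempty
  open subsets of \<open>GL\<close> meet (\<open>zariski_open_GL_meet\<close>).
\<close>

no_notation Matrix.vec_index (infixl "$" 100)

section \<open>Algebras of functions\<close>

text \<open>
  Two instances matter: the polynomial functions of the entries of a matrix, and the polynomial
  functions of one variable. Determinants and coefficients of transformed polynomials are built from
  constants by sums and products, so they stay inside such an algebra without any polynomial having to
  be written down.
\<close>

locale function_algebra =
  fixes R :: "('a \<Rightarrow> 'k::comm_ring_1) set"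
  assumes const_closed: "(\<lambda>_. c) \<in> R"
    and add_closed: "F \<in> R \<Longrightarrow> G \<in> R \<Longrightarrow> (\<lambda>x. F x + G x) \<in> R"
    and mult_closed: "F \<in> R \<Longrightarrow> G \<in> R \<Longrightarrow> (\<lambda>x. F x * G x) \<in> R"
begin

lemma sum_closed: "(\<And>i. i \<in> A \<Longrightarrow> F i \<in> R) \<Longrightarrow> (\<lambda>x. \<Sum>i\<in>A. F i x) \<in> R"
  by (induction A rule: infinite_finite_induct) (auto intro: const_closed add_closed)

lemma prod_closed: "(\<And>i. i \<in> A \<Longrightarrow> F i \<in> R) \<Longrightarrow> (\<lambda>x. \<Prod>i\<in>A. F i x) \<in> R"
proof (induction A rule: infinite_finite_induct)
  case (insert a A)
  then have "(\<lambda>x. F a x * (\<Prod>i\<in>A. F i x)) \<in> R"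
    by (intro mult_closed) auto
  then show ?case
    using insert.hyps by simp
qed (simp_all add: const_closed)

lemma power_closed: "F \<in> R \<Longrightarrow> (\<lambda>x. F x ^ n) \<in> R"
  by (induction n) (simp_all add: const_closed mult_closed)

lemma eval_closed: "(\<And>v. (\<lambda>x. a x v) \<in> R) \<Longrightarrow> (\<lambda>x. eval_with id (a x) p) \<in> R"
  unfolding eval_with_def
  by (intro sum_closed mult_closed prod_closed power_closed const_closed)

end

section \<open>Evaluation of polynomials\<close>

lemma comm_semiring_hom_id: "comm_semiring_hom (id :: 'k::comm_semiring_1 \<Rightarrow> 'k)"
  by unfold_locales auto

lemma comm_semiring_hom_const:
  "comm_semiring_hom (const :: 'k::comm_semiring_1 \<Rightarrow> ('v, 'k) mpoly)"
  by unfold_locales (simp_all add: const_def single_add mult_single)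

lemma eval_with_superset:
  fixes p :: "('v::finite, 'k::comm_semiring_1) mpoly"
  assumes "comm_semiring_hom \<phi>" "finite A" "Poly_Mapping.keys p \<subseteq> A"
  shows "eval_with \<phi> a p =
    (\<Sum>m\<in>A. \<phi> (Poly_Mapping.lookup p m) * (\<Prod>v\<in>UNIV. a v ^ Poly_Mapping.lookup m v))"
proof -
  interpret comm_semiring_hom \<phi> by fact
  have "(\<Prod>v\<in>Poly_Mapping.keys m. a v ^ Poly_Mapping.lookup m v)
      = (\<Prod>v\<in>UNIV. a v ^ Poly_Mapping.lookup m v)" for m :: "'v mon"
    by (rule prod.mono_neutral_left) (auto simp: in_keys_iff)
  then show ?thesis
    unfolding eval_with_def
    using assms(2,3) by (auto intro!: sum.mono_neutral_left simp: in_keys_iff)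
qed

lemma eval_with_single:
  fixes m :: "'v::finite mon"
  assumes "comm_semiring_hom \<phi>"
  shows "eval_with \<phi> a (Poly_Mapping.single m c)
    = \<phi> c * (\<Prod>v\<in>UNIV. a v ^ Poly_Mapping.lookup m v)"
  by (subst eval_with_superset[OF assms, of "{m}"]) auto

lemma mpoly_eq_sum_single:
  fixes p :: "('v, 'k::comm_monoid_add) mpoly"
  shows "p = (\<Sum>m\<in>Poly_Mapping.keys p. Poly_Mapping.single m (Poly_Mapping.lookup p m))"
  by (rule poly_mapping_eqI)
    (auto simp: lookup_sum lookup_single when_def in_keys_iff sum.delta')

text \<open>
  Multiplicativity reduces to products of two terms, because both sides are biadditive.
\<close>

lemma comm_semiring_hom_eval_with:
  fixes a :: "'v::finite \<Rightarrow> 'b::comm_semiring_1" and \<phi> :: "'k::comm_semiring_1 \<Rightarrow> 'b"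
  assumes "comm_semiring_hom \<phi>"
  shows "comm_semiring_hom (eval_with \<phi> a)"
proof -
  interpret comm_semiring_hom \<phi> by fact
  have add: "eval_with \<phi> a (p + q) = eval_with \<phi> a p + eval_with \<phi> a q" for p q
  proof -
    let ?A = "Poly_Mapping.keys p \<union> Poly_Mapping.keys q"
    have "finite ?A" "Poly_Mapping.keys (p + q) \<subseteq> ?A"
      using Poly_Mapping.keys_add[of p q] by auto
    then show ?thesis
      by (simp add: eval_with_superset[OF assms, of ?A] lookup_add hom_add ring_distribs sum.distrib)
  qed
  have zero: "eval_with \<phi> a 0 = 0"
    by (simp add: eval_with_def)
  have sum: "eval_with \<phi> a (\<Sum>i\<in>A. f i) = (\<Sum>i\<in>A. eval_with \<phi> a (f i))"
    for A and f :: "_ \<Rightarrow> ('v, 'k) mpoly"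
    by (induction A rule: infinite_finite_induct) (simp_all add: zero add)
  have single: "eval_with \<phi> a (Poly_Mapping.single m c * Poly_Mapping.single n d)
      = eval_with \<phi> a (Poly_Mapping.single m c) * eval_with \<phi> a (Poly_Mapping.single n d)"
    for m n c d
    by (simp add: eval_with_single[OF assms] mult_single lookup_add power_add prod.distrib
        hom_mult mult_ac)
  have mult: "eval_with \<phi> a (p * q) = eval_with \<phi> a p * eval_with \<phi> a q" for p q
  proof -
    let ?t = "\<lambda>(p :: ('v, 'k) mpoly) m. Poly_Mapping.single m (Poly_Mapping.lookup p m)"
    have split: "eval_with \<phi> a r = (\<Sum>m\<in>Poly_Mapping.keys r. eval_with \<phi> a (?t r m))" for r
      by (metis (no_types, lifting) mpoly_eq_sum_single sum sum.cong)
    have "p * q = (\<Sum>m\<in>Poly_Mapping.keys p. \<Sum>n\<in>Poly_Mapping.keys q. ?t p m * ?t q n)"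
      by (metis (no_types, lifting) mpoly_eq_sum_single sum_product sum.cong)
    then show ?thesis
      by (simp only: sum single split[of p] split[of q] sum_product)
  qed
  have one: "eval_with \<phi> a 1 = 1"
    using eval_with_single[OF assms, of a 0 1] by simp
  show ?thesis
    by unfold_locales (fact zero one add mult)+
qed

text \<open>
  Equality of ring homomorphisms on polynomials can be checked on constants and variables; this is the
  form in which the composition of two substitutions is computed.
\<close>

lemma hom_eval_with:
  fixes \<phi> :: "'k::comm_semiring_1 \<Rightarrow> 'b::comm_semiring_1"
    and \<psi> :: "'b \<Rightarrow> 'c::comm_semiring_1"
  assumes "comm_semiring_hom \<psi>"
  shows "\<psi> (eval_with \<phi> a p) = eval_with (\<psi> \<circ> \<phi>) (\<lambda>v. \<psi> (a v)) p"
proof -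
  interpret comm_semiring_hom \<psi> by fact
  show ?thesis
    by (simp add: eval_with_def hom_sum hom_mult hom_prod hom_power)
qed

lemma eval_with_of_mon_mvar:
  fixes a :: "'v::finite \<Rightarrow> 'b::comm_semiring_1"
  assumes "comm_semiring_hom \<phi>"
  shows "eval_with \<phi> a (of_mon (mvar j)) = a j"
proof -
  interpret comm_semiring_hom \<phi> by fact
  have "(\<Prod>v\<in>UNIV. a v ^ Poly_Mapping.lookup (mvar j) v) = (\<Prod>v\<in>UNIV. if v = j then a v else 1)"
    by (rule prod.cong) (simp_all add: mvar_def lookup_single when_def)
  then show ?thesis
    by (simp add: of_mon_def eval_with_single[OF assms])
qed

lemma of_mon_power: "of_mon m ^ n = (of_mon (\<Sum>i<n. m) :: ('v, 'k::comm_semiring_1) mpoly)"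
  by (induction n) (simp_all add: of_mon_def mult_single add.commute)

lemma prod_of_mon:
  "(\<Prod>v\<in>A. of_mon (m v)) = (of_mon (\<Sum>v\<in>A. m v) :: ('v, 'k::comm_semiring_1) mpoly)"
  by (induction A rule: infinite_finite_induct) (simp_all add: of_mon_def mult_single)

lemma eval_with_mvar:
  fixes p :: "('v::finite, 'k::comm_semiring_1) mpoly"
  shows "eval_with const (\<lambda>v. of_mon (mvar v)) p = p"
proof -
  have *: "(\<Sum>v\<in>UNIV. \<Sum>i<Poly_Mapping.lookup m v. mvar v) = m" for m :: "'v mon"
    by (rule poly_mapping_eqI)
      (simp add: lookup_sum mvar_def lookup_single when_def if_distrib[of "(*) _"] cong: if_cong)
  show ?thesis
    by (subst eval_with_superset[OF comm_semiring_hom_const finite_keys order_refl],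
        subst (3) mpoly_eq_sum_single)
      (simp only: of_mon_power prod_of_mon * , simp add: const_def of_mon_def mult_single)
qed

section \<open>The action of the general linear group\<close>

lemma comm_semiring_hom_change_coords:
  "comm_semiring_hom (change_coords (g :: 'k::comm_ring_1 ^ 'n ^ 'n))"
  unfolding change_coords_def
  using comm_semiring_hom_eval_with[OF comm_semiring_hom_const] .

lemma change_coords_const: "change_coords g (const c) = const c"
  unfolding change_coords_def const_def[of c]
  by (subst eval_with_single[OF comm_semiring_hom_const]) (simp add: const_def)

lemma change_coords_mvar:
  fixes g :: "'k::comm_ring_1 ^ 'n ^ 'n"
  shows "change_coords g (of_mon (mvar j)) = (\<Sum>i\<in>UNIV. const (g $ i $ j) * of_mon (mvar i))"
  unfolding change_coords_def by (rule eval_with_of_mon_mvar[OF comm_semiring_hom_const])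

lemma change_coords_mat_1: "change_coords (Finite_Cartesian_Product.mat 1 :: 'k::comm_ring_1 ^ 'n ^ 'n) p = p"
proof -
  have "(\<Sum>i\<in>UNIV. const ((Finite_Cartesian_Product.mat 1 :: 'k ^ 'n ^ 'n) $ i $ j) * of_mon (mvar i))
      = (of_mon (mvar j) :: ('n, 'k) mpoly)" for j
    by (subst sum.mono_neutral_right[of _ "{j}"]) (auto simp: Finite_Cartesian_Product.mat_def const_def)
  then show ?thesis
    by (simp add: change_coords_def eval_with_mvar)
qed

lemma invertible_mat_1: "invertible (Finite_Cartesian_Product.mat 1 :: 'k::semiring_1 ^ 'n ^ 'n)"
  unfolding invertible_def by (intro exI[of _ "Finite_Cartesian_Product.mat 1"]) simp

text \<open>
  The action is a left action, hence invertible matrices act bijectively; this is what makes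
  \<open>g(I)\<close> an ideal and lets degrees and dimensions be compared in both directions.
\<close>

lemma change_coords_change_coords:
  fixes g h :: "'k::comm_ring_1 ^ 'n ^ 'n"
  shows "change_coords h (change_coords g p) = change_coords (h ** g) p"
proof -
  interpret h: comm_semiring_hom "change_coords h" by (rule comm_semiring_hom_change_coords)
  interpret c: comm_semiring_hom "const :: 'k \<Rightarrow> ('n, 'k) mpoly" by (rule comm_semiring_hom_const)
  have lin: "change_coords h (\<Sum>i\<in>UNIV. const (g $ i $ j) * of_mon (mvar i))
      = (\<Sum>k\<in>UNIV. const ((h ** g) $ k $ j) * of_mon (mvar k))" (is "?l = ?r") for j
  proof -
    have "?l = (\<Sum>i\<in>UNIV. \<Sum>k\<in>UNIV. const (h $ k $ i * g $ i $ j) * of_mon (mvar k))"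
      by (simp only: h.hom_sum h.hom_mult change_coords_const change_coords_mvar c.hom_mult
          sum_distrib_left mult.assoc mult.left_commute)
    also have "\<dots> = (\<Sum>k\<in>UNIV. \<Sum>i\<in>UNIV. const (h $ k $ i * g $ i $ j) * of_mon (mvar k))"
      by (rule sum.swap)
    also have "\<dots> = ?r"
      by (simp add: matrix_matrix_mult_def c.hom_sum sum_distrib_right)
    finally show ?thesis .
  qed
  have "change_coords h (change_coords g p) = eval_with (change_coords h \<circ> const)
      (\<lambda>j. change_coords h (\<Sum>i\<in>UNIV. const (g $ i $ j) * of_mon (mvar i))) p"
    by (subst change_coords_def[of g]) (rule hom_eval_with[OF comm_semiring_hom_change_coords])
  also have "change_coords h \<circ> const = const"
    by (auto simp: change_coords_const)
  finally show ?thesis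
    by (simp add: lin change_coords_def[of "h ** g"])
qed

section \<open>Polynomial functions of matrices\<close>

definition matrix_polynomials :: "('k::comm_ring_1 ^ 'n ^ 'n \<Rightarrow> 'k) set"
  where "matrix_polynomials =
    {F. \<exists>p :: ('n \<times> 'n, 'k) mpoly. \<forall>g. F g = eval_with id (\<lambda>(i, j). g $ i $ j) p}"

lemma matrix_polynomials_entry:
  "(\<lambda>g. g $ i $ j) \<in> (matrix_polynomials :: ('k::comm_ring_1 ^ 'n::finite ^ 'n \<Rightarrow> 'k) set)"
  unfolding matrix_polynomials_def mem_Collect_eq
  by (intro exI[of _ "of_mon (mvar (i, j))"] allI)
    (simp add: eval_with_of_mon_mvar[OF comm_semiring_hom_id])

interpretation matrix_polynomials:
  function_algebra "matrix_polynomials :: ('k::comm_ring_1 ^ 'n::finite ^ 'n \<Rightarrow> 'k) set"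
proof
  fix c :: 'k
  show "(\<lambda>_. c) \<in> (matrix_polynomials :: ('k ^ 'n ^ 'n \<Rightarrow> 'k) set)"
    unfolding matrix_polynomials_def mem_Collect_eq const_def
    by (intro exI[of _ "Poly_Mapping.single 0 c"] allI)
      (simp add: eval_with_single[OF comm_semiring_hom_id])
next
  let ?ev = "\<lambda>(p :: ('n \<times> 'n, 'k) mpoly) (g :: 'k ^ 'n ^ 'n). eval_with id (\<lambda>(i, j). g $ i $ j) p"
  interpret ev: comm_semiring_hom "\<lambda>p. ?ev p g" for g
    by (rule comm_semiring_hom_eval_with[OF comm_semiring_hom_id])
  fix F G :: "'k ^ 'n ^ 'n \<Rightarrow> 'k"
  assume "F \<in> matrix_polynomials" "G \<in> matrix_polynomials"
  then obtain p q where F: "\<And>g. F g = ?ev p g" and G: "\<And>g. G g = ?ev q g"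
    unfolding matrix_polynomials_def by blast
  show "(\<lambda>g. F g + G g) \<in> matrix_polynomials"
    unfolding matrix_polynomials_def mem_Collect_eq F G
    by (intro exI[of _ "p + q"] allI) (rule ev.hom_add[symmetric])
  show "(\<lambda>g. F g * G g) \<in> matrix_polynomials"
    unfolding matrix_polynomials_def mem_Collect_eq F G
    by (intro exI[of _ "p * q"] allI) (rule ev.hom_mult[symmetric])
qed

section \<open>Degrees and coefficients\<close>

lemma finite_bounded_mons: "finite {m :: 'v::finite mon. \<forall>v. Poly_Mapping.lookup m v \<le> N}"
proof (rule finite_imageD)
  show "inj_on Poly_Mapping.lookup {m :: 'v mon. \<forall>v. Poly_Mapping.lookup m v \<le> N}"
    by (auto intro: inj_onI poly_mapping_eqI)
  have "finite (PiE (UNIV :: 'v set) (\<lambda>_. {..N}))"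
    by (rule finite_PiE) auto
  then show "finite (Poly_Mapping.lookup ` {m :: 'v mon. \<forall>v. Poly_Mapping.lookup m v \<le> N})"
    by (rule rev_finite_subset) auto
qed

lemma mdeg_eq_sum: "mdeg (m :: 'v::finite mon) = (\<Sum>v\<in>UNIV. Poly_Mapping.lookup m v)"
  unfolding mdeg_def by (rule sum.mono_neutral_left) (auto simp: in_keys_iff)

lemma mdeg_add: "mdeg (m + n :: 'v::finite mon) = mdeg m + mdeg n"
  by (simp add: mdeg_eq_sum lookup_add sum.distrib)

lemma lookup_le_mdeg: "Poly_Mapping.lookup m v \<le> mdeg (m :: 'v::finite mon)"
  unfolding mdeg_eq_sum by (rule member_le_sum) auto

lemma finite_mdeg_le: "finite {m :: 'v::finite mon. mdeg m \<le> d}"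
  by (rule finite_subset[OF _ finite_bounded_mons[of d]]) (auto intro: order_trans[OF lookup_le_mdeg])

text \<open>
  A fixed finite range of summation, independent of \<open>p\<close> and \<open>q\<close>, shows that the coefficients of a
  product of families of polynomials are polynomial in the coefficients of the factors.
\<close>

lemma lookup_mult_finite:
  fixes p q :: "('v::finite, 'k::comm_semiring_1) mpoly"
  shows "Poly_Mapping.lookup (p * q) m = (\<Sum>a | mdeg a \<le> mdeg m. \<Sum>b | mdeg b \<le> mdeg m.
    if m = a + b then Poly_Mapping.lookup p a * Poly_Mapping.lookup q b else 0)"
proof -
  have inner: "(\<Sum>b. Poly_Mapping.lookup q b when m = a + b)
      = (\<Sum>b | mdeg b \<le> mdeg m. Poly_Mapping.lookup q b when m = a + b)" for a
    by (rule Sum_any.expand_superset[OF finite_mdeg_le]) (auto simp: mdeg_add)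
  have "Poly_Mapping.lookup (p * q) m =
      (\<Sum>a | mdeg a \<le> mdeg m. Poly_Mapping.lookup p a * (\<Sum>b | mdeg b \<le> mdeg m. Poly_Mapping.lookup q b when m = a + b))"
    unfolding lookup_mult inner
  proof (rule Sum_any.expand_superset[OF finite_mdeg_le], rule subsetI, rule ccontr)
    fix a
    assume a: "a \<in> {a. Poly_Mapping.lookup p a
        * (\<Sum>b | mdeg b \<le> mdeg m. Poly_Mapping.lookup q b when m = a + b) \<noteq> 0}"
      and "a \<notin> {a. mdeg a \<le> mdeg m}"
    then have "m \<noteq> a + b" for b
      by (auto simp: mdeg_add)
    with a show False
      by simp
  qed
  then show ?thesis
    by (simp add: sum_distrib_left mult_when when_def if_distrib[of "(*) _"] cong: if_cong)
qed

context function_algebra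
begin

lemma coeff_const_closed: "F \<in> R \<Longrightarrow> (\<lambda>x. Poly_Mapping.lookup (const (F x)) m) \<in> R"
  by (cases "m = 0") (simp_all add: const_def lookup_single const_closed)

lemma coeff_sum_closed:
  assumes "\<And>i m. i \<in> A \<Longrightarrow> (\<lambda>x. Poly_Mapping.lookup (F i x) m) \<in> R"
  shows "(\<lambda>x. Poly_Mapping.lookup (\<Sum>i\<in>A. F i x) m) \<in> R"
  unfolding lookup_sum using assms by (rule sum_closed)

lemma coeff_mult_closed:
  fixes F G :: "'a \<Rightarrow> ('v::finite, 'k) mpoly"
  assumes "\<And>m. (\<lambda>x. Poly_Mapping.lookup (F x) m) \<in> R" "\<And>m. (\<lambda>x. Poly_Mapping.lookup (G x) m) \<in> R"
  shows "(\<lambda>x. Poly_Mapping.lookup (F x * G x) m) \<in> R"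
proof -
  have "(\<lambda>x. if m = a + b then Poly_Mapping.lookup (F x) a * Poly_Mapping.lookup (G x) b else 0) \<in> R"
    for a b
    using assms by (cases "m = a + b") (simp_all add: mult_closed const_closed)
  then show ?thesis
    unfolding lookup_mult_finite by (intro sum_closed)
qed

lemma coeff_power_closed:
  fixes F :: "'a \<Rightarrow> ('v::finite, 'k) mpoly"
  assumes "\<And>m. (\<lambda>x. Poly_Mapping.lookup (F x) m) \<in> R"
  shows "(\<lambda>x. Poly_Mapping.lookup (F x ^ n) m) \<in> R"
proof (induction n arbitrary: m)
  case 0
  then show ?case
    using const_closed by simp
next
  case (Suc n)
  then show ?case
    using coeff_mult_closed[OF assms] by simp
qed

lemma coeff_prod_closed:
  fixes F :: "'i \<Rightarrow> 'a \<Rightarrow> ('v::finite, 'k) mpoly"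
  assumes "\<And>i m. i \<in> A \<Longrightarrow> (\<lambda>x. Poly_Mapping.lookup (F i x) m) \<in> R"
  shows "(\<lambda>x. Poly_Mapping.lookup (\<Prod>i\<in>A. F i x) m) \<in> R"
  using assms
proof (induction A arbitrary: m rule: infinite_finite_induct)
  case (insert a A)
  then have "(\<lambda>x. Poly_Mapping.lookup (F a x * (\<Prod>i\<in>A. F i x)) m) \<in> R"
    by (intro coeff_mult_closed) auto
  then show ?case
    using insert.hyps by simp
qed (use const_closed in simp_all)

end

lemma coeff_change_coords:
  fixes p :: "('n::finite, 'k::comm_ring_1) mpoly"
  shows "(\<lambda>g. Poly_Mapping.lookup (change_coords g p) m) \<in> matrix_polynomials"
  unfolding change_coords_def eval_with_def
  by (intro matrix_polynomials.coeff_sum_closed matrix_polynomials.coeff_mult_closed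
      matrix_polynomials.coeff_prod_closed matrix_polynomials.coeff_power_closed
      matrix_polynomials.coeff_const_closed matrix_polynomials.const_closed matrix_polynomials_entry)

text \<open>
  Leading monomials are compared degree by degree in the filtration by degree, whose pieces are
  finite-dimensional and invariant under linear changes of coordinates.
\<close>

definition deg_le :: "nat \<Rightarrow> ('v, 'k::zero) mpoly set"
  where "deg_le d = {p. \<forall>m\<in>Poly_Mapping.keys p. mdeg m \<le> d}"

lemma deg_le_mono: "p \<in> deg_le d \<Longrightarrow> d \<le> e \<Longrightarrow> p \<in> deg_le e"
  by (auto simp: deg_le_def)

lemma deg_le_const: "const c \<in> deg_le d"
  by (auto simp: deg_le_def const_def mdeg_def)

lemma deg_le_add: "p \<in> deg_le d \<Longrightarrow> q \<in> deg_le d \<Longrightarrow> p + q \<in> deg_le d"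
  using Poly_Mapping.keys_add[of p q] by (auto simp: deg_le_def)

lemma deg_le_sum: "(\<And>i. i \<in> A \<Longrightarrow> f i \<in> deg_le d) \<Longrightarrow> (\<Sum>i\<in>A. f i) \<in> deg_le d"
  by (induction A rule: infinite_finite_induct) (simp_all add: deg_le_add, simp_all add: deg_le_def)

lemma deg_le_mult:
  fixes p q :: "('v::finite, 'k::comm_semiring_1) mpoly"
  shows "p \<in> deg_le d \<Longrightarrow> q \<in> deg_le e \<Longrightarrow> p * q \<in> deg_le (d + e)"
  using Poly_Mapping.keys_mult[of p q] by (fastforce simp: deg_le_def mdeg_add intro: add_mono)

lemma deg_le_power:
  fixes p :: "('v::finite, 'k::comm_semiring_1) mpoly"
  shows "p \<in> deg_le d \<Longrightarrow> p ^ n \<in> deg_le (n * d)"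
  by (induction n) (simp_all add: deg_le_mult, simp add: deg_le_def mdeg_def)

lemma deg_le_prod:
  fixes f :: "'i \<Rightarrow> ('v::finite, 'k::comm_semiring_1) mpoly"
  shows "(\<And>i. i \<in> A \<Longrightarrow> f i \<in> deg_le (d i)) \<Longrightarrow> (\<Prod>i\<in>A. f i) \<in> deg_le (\<Sum>i\<in>A. d i)"
  by (induction A rule: infinite_finite_induct) (simp_all add: deg_le_mult, simp_all add: deg_le_def mdeg_def)

lemma deg_le_change_coords:
  fixes g :: "'k::comm_ring_1 ^ 'n ^ 'n"
  assumes "p \<in> deg_le d"
  shows "change_coords g p \<in> deg_le d"
  unfolding change_coords_def eval_with_def
proof (rule deg_le_sum)
  fix m assume m: "m \<in> Poly_Mapping.keys p"
  have "of_mon (mvar i) \<in> (deg_le 1 :: ('n, 'k) mpoly set)" for i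
    by (auto simp: deg_le_def of_mon_def mvar_def mdeg_def)
  then have "(\<Sum>i\<in>UNIV. const (g $ i $ v) * of_mon (mvar i)) \<in> deg_le 1" for v
    using deg_le_mult[OF deg_le_const[where d = 0]] by (intro deg_le_sum) auto
  then have "(\<Sum>i\<in>UNIV. const (g $ i $ v) * of_mon (mvar i)) ^ Poly_Mapping.lookup m v
      \<in> deg_le (Poly_Mapping.lookup m v)" for v
    by (rule deg_le_power[where d = 1, unfolded mult_1_right])
  then have "const (Poly_Mapping.lookup p m) * (\<Prod>v\<in>Poly_Mapping.keys m.
      (\<Sum>i\<in>UNIV. const (g $ i $ v) * of_mon (mvar i)) ^ Poly_Mapping.lookup m v) \<in> deg_le (0 + mdeg m)"
    unfolding mdeg_def by (intro deg_le_mult deg_le_const deg_le_prod)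
  then show "const (Poly_Mapping.lookup p m) * (\<Prod>v\<in>Poly_Mapping.keys m.
      (\<Sum>i\<in>UNIV. const (g $ i $ v) * of_mon (mvar i)) ^ Poly_Mapping.lookup m v) \<in> deg_le d"
    using assms m by - (rule deg_le_mono[of _ "0 + mdeg m"], auto simp: deg_le_def[of d])
qed

section \<open>Irreducibility of the general linear group\<close>

interpretation univariate: function_algebra "range (poly :: 'k::comm_ring_1 poly \<Rightarrow> _)"
proof
  fix c :: 'k
  show "(\<lambda>_. c) \<in> range poly"
    by (intro range_eqI[of _ _ "[:c:]"]) auto
next
  fix F G :: "'k \<Rightarrow> 'k"
  assume "F \<in> range poly" "G \<in> range poly"
  then obtain p q where pq: "F = poly p" "G = poly q"
    by blast
  show "(\<lambda>x. F x + G x) \<in> range poly"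
    by (intro range_eqI[of _ _ "p + q"]) (auto simp: pq)
  show "(\<lambda>x. F x * G x) \<in> range poly"
    by (intro range_eqI[of _ _ "p * q"]) (auto simp: pq)
qed

text \<open>
  Join a point of one set to a point of the other by a line. The two polynomials that witness
  membership and the determinant restrict to univariate polynomials on this line, each of them nonzero
  at one of the two end points. Their product is a nonzero polynomial, so it does not vanish at all
  points of the infinite field, and any point where it is nonzero lies in both sets.
\<close>

lemma zariski_open_GL_meet:
  fixes U V :: "('k::field_char_0 ^ 'n::finite ^ 'n) set"
  assumes "zariski_open_GL U" "U \<noteq> {}" "zariski_open_GL V" "V \<noteq> {}"
  shows "U \<inter> V \<noteq> {}"
proof -
  let ?ev = "\<lambda>(p :: ('n \<times> 'n, 'k) mpoly) g. eval_with id (\<lambda>(i, j). g $ i $ j) p"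
  obtain P Q where U: "U = {g \<in> GL. \<exists>p\<in>P. ?ev p g \<noteq> 0}" and V: "V = {g \<in> GL. \<exists>p\<in>Q. ?ev p g \<noteq> 0}"
    using assms(1,3) unfolding zariski_open_GL_def by blast
  obtain g p where g: "g \<in> GL" "p \<in> P" "?ev p g \<noteq> 0"
    using assms(2) U by blast
  obtain h q where h: "h \<in> GL" "q \<in> Q" "?ev q h \<noteq> 0"
    using assms(4) V by blast
  define l :: "'k \<Rightarrow> 'k ^ 'n ^ 'n" where "l t = (\<chi> i j. (1 - t) * g $ i $ j + t * h $ i $ j)" for t
  \<comment> \<open>The matrix \<open>l t\<close> is affine linear in \<open>t\<close>, with \<open>l 0 = g\<close> and \<open>l 1 = h\<close>.\<close>
  have entry: "(\<lambda>t. l t $ i $ j) \<in> range poly" for i j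
    by (intro range_eqI[of _ _ "[:g $ i $ j, h $ i $ j - g $ i $ j:]"])
      (auto simp: l_def algebra_simps)
  have ev: "(\<lambda>t. ?ev r (l t)) \<in> range poly" for r
    by (intro univariate.eval_closed) (auto simp: entry split: prod.split)
  have det: "(\<lambda>t. Determinants.det (l t)) \<in> range poly"
    unfolding Determinants.det_def
    by (intro univariate.sum_closed univariate.mult_closed univariate.prod_closed
        univariate.const_closed entry)
  obtain p' where p': "(\<lambda>t. ?ev p (l t)) = poly p'"
    using ev[of p] by (rule imageE)
  obtain q' where q': "(\<lambda>t. ?ev q (l t)) = poly q'"
    using ev[of q] by (rule imageE)
  obtain d where d: "(\<lambda>t. Determinants.det (l t)) = poly d"
    using det by (rule imageE)
  note * = fun_cong[OF p'] fun_cong[OF q'] fun_cong[OF d]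
  have l: "l 0 = g" "l 1 = h"
    by (simp_all add: l_def)
  have "poly p' 0 \<noteq> 0" "poly q' 1 \<noteq> 0" "poly d 0 \<noteq> 0"
    unfolding *[symmetric] l using g h by (simp_all add: GL_def invertible_det_nz)
  then have "p' * q' * d \<noteq> 0"
    by (metis mult_eq_0_iff poly_0)
  then have "finite {t. poly (p' * q' * d) t = 0}"
    by (rule poly_roots_finite)
  then obtain t where "poly (p' * q' * d) t \<noteq> 0"
    using ex_new_if_finite[OF infinite_UNIV_char_0] by blast
  then have "?ev p (l t) \<noteq> 0" "?ev q (l t) \<noteq> 0" "l t \<in> GL"
    by (simp_all add: * GL_def invertible_det_nz)
  then have "l t \<in> U \<inter> V"
    unfolding U V using g(2) h(2) by blast
  then show ?thesis
    by blast
qed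

section \<open>Leading monomials\<close>

definition lead_mons :: "('v mon \<Rightarrow> 'v mon \<Rightarrow> bool) \<Rightarrow> ('v, 'k::zero) mpoly set \<Rightarrow> 'v mon set"
  where "lead_mons gt I = {lead_mon gt f | f. f \<in> I \<and> f \<noteq> 0}"

lemma initial_ideal_eq_span: "initial_ideal gt I = ideal.span (of_mon ` lead_mons gt I)"
  unfolding initial_ideal_def lead_mons_def by (rule arg_cong[of _ _ ideal.span]) auto

lemma keys_of_mon [simp]: "Poly_Mapping.keys (of_mon m :: ('v, 'k::zero_neq_one) mpoly) = {m}"
  by (simp add: of_mon_def)

text \<open>
  Ideals generated by monomials are spanned by the multiples of the generators.
\<close>

lemma keys_monomial_ideal:
  fixes p :: "('v, 'k::comm_ring_1) mpoly"
  assumes "p \<in> ideal.span (of_mon ` A)" "m \<in> Poly_Mapping.keys p"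
  shows "\<exists>a\<in>A. \<exists>c. m = c + a"
  using assms
proof (induction p rule: ideal.span_induct_alt)
  case (step c x y)
  then obtain a where a: "a \<in> A" "x = of_mon a"
    by blast
  from step.prems have "m \<in> Poly_Mapping.keys (c * x) \<or> m \<in> Poly_Mapping.keys y"
    using Poly_Mapping.keys_add[of "c * x" y] by blast
  then show ?case
    using step.IH keys_mult[of c x] a by fastforce
qed simp

lemma lookup_of_mon_mult:
  fixes f :: "('v, 'k::comm_semiring_1) mpoly"
  shows "Poly_Mapping.lookup (of_mon c * f) (c + m) = Poly_Mapping.lookup f m"
proof -
  have "of_mon c * f = (\<Sum>n\<in>Poly_Mapping.keys f. Poly_Mapping.single (c + n) (Poly_Mapping.lookup f n))"
    by (subst (1) mpoly_eq_sum_single[of f]) (simp add: sum_distrib_left of_mon_def mult_single)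
  then show ?thesis
    by (auto simp: lookup_sum lookup_single when_def in_keys_iff sum.delta)
qed

lemma lookup_const_mult:
  fixes p :: "('v, 'k::comm_semiring_1) mpoly"
  shows "Poly_Mapping.lookup (const c * p) m = c * Poly_Mapping.lookup p m"
proof -
  have "const c * p = (\<Sum>n\<in>Poly_Mapping.keys p. Poly_Mapping.single n (c * Poly_Mapping.lookup p n))"
    by (subst (1) mpoly_eq_sum_single[of p]) (simp add: sum_distrib_left const_def mult_single)
  then show ?thesis
    by (auto simp: lookup_sum lookup_single when_def in_keys_iff sum.delta)
qed

interpretation mpoly: vector_space "\<lambda>c p. const c * p :: ('v, 'k::field) mpoly"
  by unfold_locales
    (simp_all add: ring_distribs const_def single_add mult_single flip: mult.assoc)

text \<open>
  Closure under multiplication by \<open>c\<close> uses that \<open>c\<close> is itself the image of a polynomial under \<open>g\<close>.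
\<close>

lemma ideal_change_coords:
  assumes "ideal.subspace I" "h ** g = Finite_Cartesian_Product.mat 1" "g ** h = Finite_Cartesian_Product.mat 1"
  shows "ideal.subspace (change_coords g ` I)"
proof (rule ideal.subspaceI)
  interpret comm_semiring_hom "change_coords g" by (rule comm_semiring_hom_change_coords)
  show "0 \<in> change_coords g ` I"
    using ideal.subspace_0[OF assms(1)] by (intro image_eqI[of _ _ 0]) simp_all
  show "x + y \<in> change_coords g ` I" if xy: "x \<in> change_coords g ` I" "y \<in> change_coords g ` I" for x y
  proof -
    obtain p q where "p \<in> I" "q \<in> I" "x = change_coords g p" "y = change_coords g q"
      using xy by blast
    then show ?thesis
      using ideal.subspace_add[OF assms(1)] by (intro image_eqI[of _ _ "p + q"]) (simp_all only: hom_add)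
  qed
  show "c * x \<in> change_coords g ` I" if x: "x \<in> change_coords g ` I" for c x
  proof -
    obtain f where f: "f \<in> I" "x = change_coords g f"
      using x by blast
    have "c * x = change_coords g (change_coords h c * f)"
      by (simp only: f(2) hom_mult change_coords_change_coords assms(3) change_coords_mat_1)
    then show ?thesis
      using ideal.subspace_scale[OF assms(1) f(1)] by blast
  qed
qed

context
  fixes gt :: "'n::{finite, linorder} mon \<Rightarrow> 'n mon \<Rightarrow> bool"
  assumes order: "monomial_order gt"
begin

lemma gt_irrefl: "\<not> gt m m"
  using order unfolding monomial_order_def irreflp_def by blast

lemma gt_trans: "gt a b \<Longrightarrow> gt b c \<Longrightarrow> gt a c"
  using order unfolding monomial_order_def by (blast dest: transpD)

lemma gt_total: "a \<noteq> b \<Longrightarrow> gt a b \<or> gt b a"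
  using order unfolding monomial_order_def by (blast dest: totalpD)

lemma gt_add: "gt a b \<Longrightarrow> gt (c + a) (c + b)"
  using order unfolding monomial_order_def by (simp only: add.commute[of c])

lemma gt_mdeg:
  assumes "gt a b"
  shows "mdeg b \<le> mdeg a"
proof (rule ccontr)
  assume "\<not> mdeg b \<le> mdeg a"
  then have "gt b a"
    using order unfolding monomial_order_def by simp
  then show False
    using assms gt_trans gt_irrefl by blast
qed

text \<open>
  The converse of \<open>gt\<close> is a strict linear order; with it the induction
  over a finite set by adding its largest element becomes available.
\<close>

interpretation tau: linorder "\<lambda>a b. a = b \<or> gt b a" "\<lambda>a b. gt b a"
  by unfold_locales (use gt_irrefl gt_trans gt_total in blast)+

lemma lead_mon_eqI:
  assumes "m \<in> Poly_Mapping.keys f" "\<And>m'. m' \<in> Poly_Mapping.keys f \<Longrightarrow> m' \<noteq> m \<Longrightarrow> gt m m'"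
  shows "lead_mon gt f = m"
  unfolding lead_mon_def
proof (rule the_equality)
  show "m \<in> Poly_Mapping.keys f \<and> (\<forall>m'\<in>Poly_Mapping.keys f. m' \<noteq> m \<longrightarrow> gt m m')"
    using assms by blast
  show "n = m" if n: "n \<in> Poly_Mapping.keys f \<and> (\<forall>m'\<in>Poly_Mapping.keys f. m' \<noteq> n \<longrightarrow> gt n m')" for n
    using n assms gt_irrefl[of m] gt_trans[of m n m] by metis
qed

lemma lead_mon:
  assumes "f \<noteq> 0"
  shows "lead_mon gt f \<in> Poly_Mapping.keys f"
    and "m \<in> Poly_Mapping.keys f \<Longrightarrow> m \<noteq> lead_mon gt f \<Longrightarrow> gt (lead_mon gt f) m"
proof -
  have "\<exists>m\<in>A. \<forall>m'\<in>A. m' \<noteq> m \<longrightarrow> gt m m'" if "finite A" "A \<noteq> {}" for A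
    using that
  proof (induction A rule: tau.finite_linorder_max_induct)
    case (insert b A)
    then show ?case
      by (intro bexI[of _ b]) simp_all
  qed simp
  from this[of "Poly_Mapping.keys f"] obtain m0
    where m0: "m0 \<in> Poly_Mapping.keys f" "\<forall>m'\<in>Poly_Mapping.keys f. m' \<noteq> m0 \<longrightarrow> gt m0 m'"
    using assms by auto
  then have "lead_mon gt f = m0"
    by (intro lead_mon_eqI) auto
  then show "lead_mon gt f \<in> Poly_Mapping.keys f"
      "m \<in> Poly_Mapping.keys f \<Longrightarrow> m \<noteq> lead_mon gt f \<Longrightarrow> gt (lead_mon gt f) m"
    using m0 by auto
qed

lemma lookup_above_lead_mon: "gt m (lead_mon gt f) \<Longrightarrow> Poly_Mapping.lookup f m = 0"
  using lead_mon(2)[of f m] gt_irrefl[of m] gt_trans[of m "lead_mon gt f" m]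
  by (cases "f = 0") (simp, metis in_keys_iff)

text \<open>
  Since the order is graded, the leading monomial determines the degree.
\<close>

lemma lead_mon_deg_le: "f \<noteq> 0 \<Longrightarrow> f \<in> deg_le d \<longleftrightarrow> mdeg (lead_mon gt f) \<le> d"
  unfolding deg_le_def mem_Collect_eq
  using lead_mon[of f] gt_mdeg[of "lead_mon gt f"] by (metis le_trans)

lemma lead_mons_add:
  fixes I :: "('n, 'k::comm_ring_1) mpoly set"
  assumes "ideal.subspace I" "m \<in> lead_mons gt I"
  shows "c + m \<in> lead_mons gt I"
proof -
  obtain f where f: "f \<in> I" "f \<noteq> 0" "m = lead_mon gt f"
    using assms(2) by (auto simp: lead_mons_def)
  have key: "c + m \<in> Poly_Mapping.keys (of_mon c * f)"
    using lead_mon(1)[OF f(2)] by (simp add: in_keys_iff lookup_of_mon_mult f(3))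
  have "gt (c + m) m'" if m': "m' \<in> Poly_Mapping.keys (of_mon c * f)" "m' \<noteq> c + m" for m'
  proof -
    obtain n where "n \<in> Poly_Mapping.keys f" "m' = c + n"
      using m'(1) keys_mult[of "of_mon c" f] by auto
    then show ?thesis
      using m'(2) lead_mon(2)[OF f(2), of n] gt_add by (auto simp: f(3))
  qed
  with key have "lead_mon gt (of_mon c * f) = c + m"
    by (rule lead_mon_eqI)
  moreover have "of_mon c * f \<in> I"
    using ideal.subspace_scale[OF assms(1) f(1)] .
  moreover have "of_mon c * f \<noteq> 0"
    using key by auto
  ultimately show ?thesis
    unfolding lead_mons_def by force
qed

text \<open>
  Leading monomials are closed under multiplication by monomials, so the initial ideal contains no
  further monomials.
\<close>

lemma of_mon_in_initial_ideal_iff: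
  fixes I :: "('n, 'k::comm_ring_1) mpoly set"
  assumes "ideal.subspace I"
  shows "of_mon m \<in> initial_ideal gt I \<longleftrightarrow> m \<in> lead_mons gt I"
proof
  assume "of_mon m \<in> initial_ideal gt I"
  then obtain a c where "a \<in> lead_mons gt I" "m = c + a"
    using keys_monomial_ideal[of "of_mon m" "lead_mons gt I" m]
    by (auto simp: initial_ideal_eq_span)
  then show "m \<in> lead_mons gt I"
    using lead_mons_add[OF assms] by simp
qed (auto simp: initial_ideal_eq_span intro: ideal.span_base)

section \<open>Counting dimensions\<close>

text \<open>
  The element with the largest leading monomial is not in the span of the others, because their
  coefficient at this monomial is zero.
\<close>

lemma independent_distinct_lead_mons:
  fixes h :: "'n mon \<Rightarrow> ('n, 'k::field) mpoly"
  assumes "finite M" "\<And>m. m \<in> M \<Longrightarrow> h m \<noteq> 0" "\<And>m. m \<in> M \<Longrightarrow> lead_mon gt (h m) = m"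
  shows "mpoly.independent (h ` M)"
  using assms
proof (induction M rule: tau.finite_linorder_max_induct)
  case (insert b A)
  have "mpoly.subspace {p :: ('n, 'k) mpoly. Poly_Mapping.lookup p b = 0}"
    by (rule mpoly.subspaceI) (simp_all add: lookup_add lookup_const_mult)
  moreover have "h ` A \<subseteq> {p. Poly_Mapping.lookup p b = 0}"
    using insert.hyps insert.prems(2) by (auto intro!: lookup_above_lead_mon)
  ultimately have "mpoly.span (h ` A) \<subseteq> {p. Poly_Mapping.lookup p b = 0}"
    by (intro mpoly.span_minimal)
  moreover have "Poly_Mapping.lookup (h b) b \<noteq> 0"
    using lead_mon(1)[of "h b"] insert.prems by (simp add: in_keys_iff)
  ultimately have "h b \<notin> mpoly.span (h ` A)"
    by blast
  then show ?case
    using insert by (simp add: mpoly.independent_insertI)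
qed (simp add: mpoly.independent_empty)

text \<open>
  Division by the chosen elements \<open>f m\<close>: subtracting a multiple of \<open>f m\<close>, for \<open>m\<close> the leading monomial
  of \<open>p\<close>, lowers the leading monomial. The order is graded, so below a monomial there are only finitely
  many others and the process ends.
\<close>

lemma span_lead_mons:
  fixes I :: "('n, 'k::field) mpoly set"
  assumes I: "ideal.subspace I"
    and f: "\<And>m. m \<in> lead_mons gt I \<Longrightarrow> f m \<in> I \<and> f m \<noteq> 0 \<and> lead_mon gt (f m) = m"
    and p: "p \<in> I" "p \<in> deg_le d"
  shows "p \<in> mpoly.span (f ` {m \<in> lead_mons gt I. mdeg m \<le> d})"
  using p
proof (induction "card {m. gt (lead_mon gt p) m}" arbitrary: p rule: less_induct)
  case less
  let ?V = "mpoly.span (f ` {m \<in> lead_mons gt I. mdeg m \<le> d})" and ?m = "lead_mon gt p"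
  show ?case
  proof (cases "p = 0")
    case True
    then show ?thesis
      by (simp add: mpoly.span_zero)
  next
    case False
    have m: "?m \<in> lead_mons gt I"
      using less.prems(1) False by (auto simp: lead_mons_def)
    note fm = f[OF m]
    \<comment> \<open>The scalar that cancels the leading term of \<open>p\<close>.\<close>
    define c where "c = Poly_Mapping.lookup p ?m / Poly_Mapping.lookup (f ?m) ?m"
    define q where "q = p - const c * f ?m"
    have md: "mdeg ?m \<le> d"
      using less.prems(2) lead_mon_deg_le[OF False] by blast
    have fV: "const c * f ?m \<in> ?V"
      using m md by (intro mpoly.span_scale mpoly.span_base) auto
    have "q \<in> ?V"
    proof (cases "q = 0")
      case True
      then show ?thesis
        by (simp add: mpoly.span_zero)
    next
      case q0: False
      have "q \<in> I"
        unfolding q_def using fm I less.prems(1) by (simp add: ideal.subspace_diff ideal.subspace_scale)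
      moreover have lq: "gt ?m (lead_mon gt q)"
      proof -
        have "Poly_Mapping.lookup q ?m = 0"
          using lead_mon(1)[of "f ?m"] fm
          by (simp add: q_def c_def lookup_minus lookup_const_mult in_keys_iff)
        moreover have "Poly_Mapping.lookup q m' = 0" if "gt m' ?m" for m'
          using that fm lookup_above_lead_mon[of m' p] lookup_above_lead_mon[of m' "f ?m"]
          by (simp add: q_def lookup_minus lookup_const_mult)
        ultimately show ?thesis
          using lead_mon(1)[OF q0] gt_total[of ?m "lead_mon gt q"] by (metis in_keys_iff)
      qed
      moreover have "q \<in> deg_le d"
        using lead_mon_deg_le[OF q0] gt_mdeg[OF lq] md by simp
      moreover have "card {m. gt (lead_mon gt q) m} < card {m. gt ?m m}"
      proof (rule psubset_card_mono)
        show "finite {m. gt ?m m}"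
          by (rule finite_subset[OF _ finite_mdeg_le[of "mdeg ?m"]]) (auto intro: gt_mdeg)
        show "{m. gt (lead_mon gt q) m} \<subset> {m. gt ?m m}"
          using lq gt_trans gt_irrefl by blast
      qed
      ultimately show ?thesis
        using less.hyps by blast
    qed
    then have "q + const c * f ?m \<in> ?V"
      using fV by (rule mpoly.span_add)
    then show ?thesis
      by (simp add: q_def)
  qed
qed

text \<open>
  In degrees up to that of \<open>m\<close>, elements of \<open>g(I)\<close> with distinct leading monomials are independent,
  and they lie in the image of the span of as many elements of \<open>I\<close> as \<open>I\<close> has leading monomials.
  So \<open>g(I)\<close> cannot have more leading monomials than \<open>I\<close>.
\<close>

lemma lead_mons_change_coords_eq:
  fixes I :: "('n, 'k::field) mpoly set"
  assumes I: "ideal.subspace I" and inv: "h ** g = Finite_Cartesian_Product.mat 1" "g ** h = Finite_Cartesian_Product.mat 1"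
    and sub: "lead_mons gt I \<subseteq> lead_mons gt (change_coords g ` I)"
  shows "lead_mons gt (change_coords g ` I) = lead_mons gt I"
proof (rule antisym[OF subsetI sub])
  let ?J = "change_coords g ` I"
  fix m assume m: "m \<in> lead_mons gt ?J"
  interpret comm_semiring_hom "change_coords g" by (rule comm_semiring_hom_change_coords)
  have pick: "\<exists>f. \<forall>m\<in>lead_mons gt L. f m \<in> L \<and> f m \<noteq> 0 \<and> lead_mon gt (f m) = m"
    for L :: "('n, 'k) mpoly set"
    by (rule bchoice) (auto simp: lead_mons_def)
  obtain f where f: "\<And>m. m \<in> lead_mons gt I \<Longrightarrow> f m \<in> I \<and> f m \<noteq> 0 \<and> lead_mon gt (f m) = m"
    using pick[of I] by blast
  obtain k where k: "\<And>m. m \<in> lead_mons gt ?J \<Longrightarrow> k m \<in> ?J \<and> k m \<noteq> 0 \<and> lead_mon gt (k m) = m"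
    using pick[of ?J] by blast
  define M where "M = {n \<in> lead_mons gt I. mdeg n \<le> mdeg m}"
  define N where "N = {n \<in> lead_mons gt ?J. mdeg n \<le> mdeg m}"
  have fin: "finite M" "finite N"
    by (auto simp: M_def N_def intro: finite_subset[OF _ finite_mdeg_le[of "mdeg m"]])
  have span: "change_coords g p \<in> mpoly.span (change_coords g ` f ` M)"
    if "p \<in> mpoly.span (f ` M)" for p
    using that
  proof (induction p rule: mpoly.span_induct_alt)
    case base
    then show ?case
      by (simp add: mpoly.span_zero)
  next
    case (step c x y)
    then have "const c * change_coords g x \<in> mpoly.span (change_coords g ` f ` M)"
      by (intro mpoly.span_scale mpoly.span_base imageI)
    then show ?case
      unfolding hom_add hom_mult change_coords_const using step.IH by (rule mpoly.span_add)
  qed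
  have "k n \<in> mpoly.span (change_coords g ` f ` M)" if n: "n \<in> N" for n
  proof -
    obtain p where p: "p \<in> I" "k n = change_coords g p"
      using n k[of n] by (auto simp: N_def)
    have "k n \<in> deg_le (mdeg m)"
      using n k[of n] lead_mon_deg_le[of "k n"] by (auto simp: N_def)
    then have "change_coords h (k n) \<in> deg_le (mdeg m)"
      by (rule deg_le_change_coords)
    then have "p \<in> deg_le (mdeg m)"
      by (simp add: p change_coords_change_coords inv change_coords_mat_1)
    then have "p \<in> mpoly.span (f ` M)"
      unfolding M_def using span_lead_mons[OF I _ p(1), of f] f by blast
    then show ?thesis
      unfolding p(2) by (rule span)
  qed
  moreover have "mpoly.independent (k ` N)"
    using k by (intro independent_distinct_lead_mons fin) (auto simp: N_def)
  moreover have "finite (change_coords g ` f ` M)"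
    using fin(1) by simp
  ultimately have "card (k ` N) \<le> card (change_coords g ` f ` M)"
    using mpoly.independent_span_bound[of "change_coords g ` f ` M" "k ` N"] by blast
  also have "\<dots> \<le> card M"
    using card_image_le[OF fin(1), of "change_coords g \<circ> f"] by (simp only: image_comp)
  also have "card (k ` N) = card N"
  proof (rule card_image, rule inj_on_inverseI)
    show "lead_mon gt (k n) = n" if "n \<in> N" for n
      using that k[of n] by (simp add: N_def)
  qed
  finally have "M = N"
    using sub fin by (intro card_seteq) (auto simp: M_def N_def)
  then show "m \<in> lead_mons gt I"
    using m by (auto simp: M_def N_def)
qed

section \<open>Generic coordinates\<close>

text \<open>
  Being a leading monomial is an open condition at the identity, provided that all larger monomials of
  the same degree are leading monomials too. Then there are as many elements of \<open>I\<close> to combine as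
  there are coefficients to prescribe: zero at the monomials above \<open>b\<close>, nonzero at \<open>b\<close>.
\<close>

lemma lead_mons_change_coords_generic:
  fixes I :: "('n, 'k::field) mpoly set"
  assumes I: "ideal.subspace I"
    and above: "\<And>m. mdeg m = mdeg b \<Longrightarrow> m = b \<or> gt m b \<Longrightarrow> m \<in> lead_mons gt I"
  shows "\<exists>D\<in>matrix_polynomials. D (Finite_Cartesian_Product.mat 1) \<noteq> 0 \<and>
    (\<forall>g. D g \<noteq> 0 \<longrightarrow> b \<in> lead_mons gt (change_coords g ` I))"
proof -
  let ?A = "{m. mdeg m = mdeg b \<and> (m = b \<or> gt m b)}"
  have "\<exists>xs. set xs = A \<and> sorted_wrt gt xs" if "finite A" for A
    using that
  proof (induction A rule: tau.finite_linorder_max_induct)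
    case (insert b A)
    then obtain xs where "set xs = A" "sorted_wrt gt xs"
      by blast
    then show ?case
      using insert.hyps by (intro exI[of _ "b # xs"]) auto
  qed simp
  moreover have "finite ?A"
    by (rule finite_subset[OF _ finite_mdeg_le[of "mdeg b"]]) auto
  ultimately obtain xs where xs: "set xs = ?A" "sorted_wrt gt xs"
    by blast
  define s where "s = length xs"
  have nth: "xs ! i \<in> ?A" if "i < s" for i
    using that xs(1) nth_mem[of i xs] by (simp add: s_def)
  have sorted: "gt (xs ! i) (xs ! j)" if "i < j" "j < s" for i j
    using that xs(2) by (simp add: s_def sorted_wrt_nth_less)
  have "\<exists>f. \<forall>i\<in>{..<s}. f i \<in> I \<and> f i \<noteq> 0 \<and> lead_mon gt (f i) = xs ! i"
  proof (rule bchoice, rule ballI)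
    fix i assume "i \<in> {..<s}"
    then have "xs ! i \<in> lead_mons gt I"
      using nth[of i] above by auto
    then show "\<exists>f. f \<in> I \<and> f \<noteq> 0 \<and> lead_mon gt f = xs ! i"
      by (auto simp: lead_mons_def)
  qed
  then obtain f where f: "\<And>i. i < s \<Longrightarrow> f i \<in> I \<and> f i \<noteq> 0 \<and> lead_mon gt (f i) = xs ! i"
    by blast
  define A
    where "A g = Matrix.mat s s (\<lambda>(i, j). Poly_Mapping.lookup (change_coords g (f i)) (xs ! j))" for g
  have A: "A g \<in> carrier_mat s s" for g
    by (simp add: A_def)
  \<comment> \<open>For \<open>g = 1\<close>, row \<open>i\<close> vanishes left of the diagonal as \<open>xs\<close> is decreasing and \<open>f i\<close> leads with \<open>xs ! i\<close>.\<close>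
  define D where "D g = Determinant.det (A g)" for g
  have "D = (\<lambda>g. \<Sum>p | p permutes {0..<s}. signof p *
      (\<Prod>i\<in>{0..<s}. Poly_Mapping.lookup (change_coords g (f i)) (xs ! p i)))"
  proof
    fix g
    have "(\<Prod>i = 0..<s. A g $$ (i, p i))
        = (\<Prod>i\<in>{0..<s}. Poly_Mapping.lookup (change_coords g (f i)) (xs ! p i))"
      if "p permutes {0..<s}" for p
      using permutes_in_image[OF that] by (intro prod.cong) (auto simp: A_def)
    then show "D g = (\<Sum>p | p permutes {0..<s}. signof p *
        (\<Prod>i\<in>{0..<s}. Poly_Mapping.lookup (change_coords g (f i)) (xs ! p i)))"
      by (simp add: D_def det_def'[OF A])
  qed
  also have "\<dots> \<in> matrix_polynomials"
    by (intro matrix_polynomials.sum_closed matrix_polynomials.mult_closed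
        matrix_polynomials.prod_closed matrix_polynomials.const_closed coeff_change_coords)
  finally have "D \<in> matrix_polynomials" .
  moreover have "D (Finite_Cartesian_Product.mat 1) \<noteq> 0"
  proof -
    have "upper_triangular (A (Finite_Cartesian_Product.mat 1))"
      by (intro upper_triangularI)
        (use f sorted in \<open>auto simp: A_def change_coords_mat_1 intro!: lookup_above_lead_mon\<close>)
    moreover have diag: "Poly_Mapping.lookup (f i) (xs ! i) \<noteq> 0" if "i < s" for i
      using lead_mon(1)[of "f i"] f[OF that] by (simp add: in_keys_iff)
    have "0 \<notin> set (diag_mat (A (Finite_Cartesian_Product.mat 1)))"
      using diag by (auto simp: diag_mat_def A_def change_coords_mat_1)
    ultimately show ?thesis
      unfolding D_def using upper_triangular_imp_det_eq_0_iff[OF A] by blast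
  qed
  moreover have "b \<in> lead_mons gt (change_coords g ` I)" if D: "D g \<noteq> 0" for g
  proof -
    interpret comm_semiring_hom "change_coords g" by (rule comm_semiring_hom_change_coords)
    obtain k where k: "k < s" "xs ! k = b"
      using xs(1) by (auto simp: s_def in_set_conv_nth set_eq_iff)
    \<comment> \<open>Row \<open>k\<close> of the adjugate combines the rows of \<open>A g\<close> to \<open>D g\<close> times the \<open>k\<close>-th unit vector.\<close>
    define p where "p = (\<Sum>i\<in>{0..<s}. const (adj_mat (A g) $$ (k, i)) * f i)"
    define q where "q = change_coords g p"
    have pI: "p \<in> I"
      unfolding p_def using f by (intro ideal.subspace_sum I ideal.subspace_scale) auto
    have q: "q = (\<Sum>i\<in>{0..<s}. const (adj_mat (A g) $$ (k, i)) * change_coords g (f i))"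
      by (simp add: q_def p_def hom_sum hom_mult change_coords_const)
    have coeff: "Poly_Mapping.lookup q (xs ! j) = (if j = k then D g else 0)" if j: "j < s" for j
    proof -
      have "Poly_Mapping.lookup q (xs ! j) = (\<Sum>i\<in>{0..<s}. adj_mat (A g) $$ (k, i) * A g $$ (i, j))"
        using j by (simp add: q lookup_sum lookup_const_mult A_def)
      also have "\<dots> = (adj_mat (A g) * A g) $$ (k, j)"
        using adj_mat(1)[OF A, of g] A[of g] k(1) j by (simp add: scalar_prod_def)
      also have "\<dots> = (if j = k then D g else 0)"
        using k(1) j by (simp add: adj_mat(3)[OF A] D_def)
      finally show ?thesis .
    qed
    have fdeg: "f i \<in> deg_le (mdeg b)" if "i < s" for i
      using f[OF that] nth[OF that] lead_mon_deg_le[of "f i" "mdeg b"] by auto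
    have "const (adj_mat (A g) $$ (k, i)) * f i \<in> deg_le (0 + mdeg b)" if "i \<in> {0..<s}" for i
      by (rule deg_le_mult[OF deg_le_const fdeg]) (use that in simp)
    then have "p \<in> deg_le (mdeg b)"
      unfolding p_def add_0 by (rule deg_le_sum)
    then have deg: "q \<in> deg_le (mdeg b)"
      unfolding q_def by (rule deg_le_change_coords)
    have key: "b \<in> Poly_Mapping.keys q"
      using coeff[OF k(1)] D k(2) by (simp add: in_keys_iff)
    have "gt b m" if m: "m \<in> Poly_Mapping.keys q" "m \<noteq> b" for m
    proof (rule ccontr)
      assume "\<not> gt b m"
      then have "gt m b"
        using gt_total m(2) by blast
      moreover have "mdeg m \<le> mdeg b"
        using deg m(1) by (simp add: deg_le_def)
      ultimately have "m \<in> ?A"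
        using gt_mdeg[of m b] by simp
      then obtain j where "j < s" "m = xs ! j"
        using xs(1) by (metis in_set_conv_nth s_def)
      then show False
        using coeff[of j] m k(2) by (auto simp: in_keys_iff split: if_splits)
    qed
    with key have "lead_mon gt q = b"
      by (rule lead_mon_eqI)
    moreover have "q \<noteq> 0"
      using key by auto
    ultimately show ?thesis
      using pI unfolding lead_mons_def q_def by blast
  qed
  ultimately show ?thesis
    by blast
qed

end

theorem lemma3p6:
  fixes gt :: "'n::{finite, linorder} mon \<Rightarrow> 'n mon \<Rightarrow> bool"
    and I :: "('n, 'k::{alg_closed_field, field_char_0}) mpoly set"
  assumes "monomial_order gt"
    and "homogeneous_ideal I"
    and "segment_ideal gt (initial_ideal gt I)"
  shows "gin gt I = initial_ideal gt I"
proof -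
  note order = assms(1)
  have I: "ideal.subspace I"
    using assms(2) by (auto simp: homogeneous_ideal_def)
  obtain B where B: "segment gt B" and in_I: "initial_ideal gt I = ideal.span (of_mon ` B)"
    using assms(3) by (auto simp: segment_ideal_def)
  have B_lead: "B \<subseteq> lead_mons gt I"
  proof
    fix b assume "b \<in> B"
    then have "of_mon b \<in> initial_ideal gt I"
      unfolding in_I by (intro ideal.span_base imageI)
    then show "b \<in> lead_mons gt I"
      by (simp add: of_mon_in_initial_ideal_iff[OF order I])
  qed
  have "\<forall>b\<in>B. \<exists>D. D \<in> matrix_polynomials \<and> D (Finite_Cartesian_Product.mat 1) \<noteq> 0 \<and>
      (\<forall>g. D g \<noteq> 0 \<longrightarrow> b \<in> lead_mons gt (change_coords g ` I))"
  proof
    fix b assume b: "b \<in> B"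
    have "m \<in> lead_mons gt I" if "mdeg m = mdeg b" "m = b \<or> gt m b" for m
      using that b B B_lead by (auto simp: segment_def)
    then show "\<exists>D. D \<in> matrix_polynomials \<and> D (Finite_Cartesian_Product.mat 1) \<noteq> 0 \<and>
        (\<forall>g. D g \<noteq> 0 \<longrightarrow> b \<in> lead_mons gt (change_coords g ` I))"
      using lead_mons_change_coords_generic[OF order I] by blast
  qed
  then obtain D where D: "\<And>b. b \<in> B \<Longrightarrow> D b \<in> matrix_polynomials"
      "\<And>b. b \<in> B \<Longrightarrow> D b (Finite_Cartesian_Product.mat 1) \<noteq> 0"
      "\<And>b g. b \<in> B \<Longrightarrow> D b g \<noteq> 0 \<Longrightarrow> b \<in> lead_mons gt (change_coords g ` I)"
    using bchoice by metis
  have "(\<lambda>g. \<Prod>b\<in>B. D b g) \<in> matrix_polynomials"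
    using D(1) by (rule matrix_polynomials.prod_closed)
  then obtain P :: "('n \<times> 'n, 'k) mpoly"
    where P: "\<And>g. (\<Prod>b\<in>B. D b g) = eval_with id (\<lambda>(i, j). g $ i $ j) P"
    unfolding matrix_polynomials_def by blast
  define U where "U = {g \<in> GL. (\<Prod>b\<in>B. D b g) \<noteq> 0}"
  have U_open: "zariski_open_GL U"
    unfolding zariski_open_GL_def U_def P by (intro exI[of _ "{P}"]) simp
  have fin_B: "finite B"
    using B by (simp add: segment_def)
  then have "Finite_Cartesian_Product.mat 1 \<in> U"
    using D(2) by (simp add: U_def GL_def invertible_mat_1)
  then have U_ne: "U \<noteq> {}"
    by blast
  have in_U: "initial_ideal gt (change_coords g ` I) = initial_ideal gt I" if g: "g \<in> U" for g
  proof -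
    obtain h where h: "g ** h = Finite_Cartesian_Product.mat 1" "h ** g = Finite_Cartesian_Product.mat 1"
      using g by (auto simp: U_def GL_def invertible_def)
    have gI: "ideal.subspace (change_coords g ` I)"
      by (rule ideal_change_coords[OF I h(2) h(1)])
    have B_gI: "B \<subseteq> lead_mons gt (change_coords g ` I)"
      using g D(3) fin_B by (auto simp: U_def)
    have "lead_mons gt I \<subseteq> lead_mons gt (change_coords g ` I)"
    proof
      fix m assume "m \<in> lead_mons gt I"
      then have "of_mon m \<in> ideal.span (of_mon ` B :: ('n, 'k) mpoly set)"
        by (simp add: of_mon_in_initial_ideal_iff[OF order I] flip: in_I)
      then obtain b c where "b \<in> B" "m = c + b"
        using keys_monomial_ideal[of "of_mon m" B m] by auto
      then show "m \<in> lead_mons gt (change_coords g ` I)"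
        using B_gI lead_mons_add[OF order gI] by blast
    qed
    then show ?thesis
      using lead_mons_change_coords_eq[OF order I h(2) h(1)] by (simp add: initial_ideal_eq_span)
  qed
  show ?thesis
    unfolding gin_def
  proof (rule the_equality)
    show "\<exists>U. zariski_open_GL U \<and> U \<noteq> {} \<and>
        (\<forall>g\<in>U. initial_ideal gt (change_coords g ` I) = initial_ideal gt I)"
      using U_open U_ne in_U by blast
  next
    fix J assume "\<exists>V. zariski_open_GL V \<and> V \<noteq> {} \<and>
        (\<forall>g\<in>V. initial_ideal gt (change_coords g ` I) = J)"
    then obtain V where V: "zariski_open_GL V" "V \<noteq> {}"
        "\<And>g. g \<in> V \<Longrightarrow> initial_ideal gt (change_coords g ` I) = J"
      by blast
    obtain g where "g \<in> U" "g \<in> V"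
      using zariski_open_GL_meet[OF U_open U_ne V(1,2)] by blast
    then show "J = initial_ideal gt I"
      using in_U V(3) by metis
  qed
qed

end
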